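(* Let $\mathcal{C}$ be an additive category and $n$ a positive integer. Then $\mathcal{C}$ is an $n$-abelian category in which every $n$-exact sequence is contractible if and only if $\mathcal{C}$ is semisimple.
   Context: Composition is written left to right. **Semisimple.** An additive category is semisimple if every morphism $f\colon A\to B$ factors as $f=pi$ with $p$ a split epimorphism (applied first) and $i$ a split monomorphism. **Contractible.** A complex is contractible if its identity morphism is null-homotopic. **$n$-exact sequences.** In an additive category $\mathcal{C}$, an $n$-cokernel of $d^0\colon X^0\to X^1$ is a sequence $(d^1,\dots,d^n)$, $X^1\to\cdots\to X^{n+1}$, such that $0\to\mathcal{C}(X^{n+1},Y)\to\cdots\to\mathcal{C}(X^1,Y)\to\mathcal{C}(X^0,Y)$ is exact for all $Y\in\mathcal{C}$; dually, an $n$-kernel of $d^n\colon X^n\to X^{n+1}$ is a sequence $(d^0,\dots,d^{n-1})$, $X^0\to\cdots\to X^n$, such that $0\to\mathcal{C}(Y,X^0)\to\cdots\to\mathcal{C}(Y,X^n)\to\mathcal{C}(Y,X^{n+1})$ is exact for all $Y$. An $n$-exact sequence is a complex $X^0\xrightarrow{d^0}\cdots\xrightarrow{d^n}X^{n+1}$ such that $(d^0,\dots,d^{n-1})$ is an $n$-kernel of $d^n$ and $(d^1,\dots,d^n)$ is an $n$-cokernel of $d^0$. **$n$-abelian category.** An additive category $\mathcal{M}$ such that: (A0) $\mathcal{M}$ is idempotent complete; (A1) every morphism in $\mathcal{M}$ has an $n$-kernel and an $n$-cokernel; (A2) for every monomorphism $f^0\colon X^0\to X^1$ in $\mathcal{M}$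 and every $n$-cokernel $(f^1,\dots,f^n)$ of $f^0$, the sequence $(f^0,f^1,\dots,f^n)$ is $n$-exact; (A2$^{\mathrm{op}}$) for every epimorphism $g^n\colon X^n\to X^{n+1}$ in $\mathcal{M}$ and every $n$-kernel $(g^0,\dots,g^{n-1})$ of $g^n$, the sequence $(g^0,\dots,g^n)$ is $n$-exact. *)

theory Defs
  imports "HOL-Algebra.Coset"
begin

section \<open>Additive categories\<close>

text \<open>Composition is written from left to right: \<open>f \<odot> g\<close> is ``first f, then g''. It is only
  meaningful when the target of \<open>f\<close> is the source of \<open>g\<close>; likewise \<open>f \<boxplus> g\<close> is only meaningful for
  parallel morphisms.\<close>

record ('o, 'm) precat =
  Ob :: "'o set"
  Mor :: "'m set"
  src :: "'m \<Rightarrow> 'o"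
  tgt :: "'m \<Rightarrow> 'o"
  idm :: "'o \<Rightarrow> 'm"
  cmp :: "'m \<Rightarrow> 'm \<Rightarrow> 'm"  (infixl "\<odot>\<index>" 70)
  plusm :: "'m \<Rightarrow> 'm \<Rightarrow> 'm"  (infixl "\<boxplus>\<index>" 65)
  zerom :: "'o \<Rightarrow> 'o \<Rightarrow> 'm"

definition Hom :: "('o, 'm, 'e) precat_scheme \<Rightarrow> 'o \<Rightarrow> 'o \<Rightarrow> 'm set" where
  "Hom C A B = {f \<in> Mor C. src C f = A \<and> tgt C f = B}"

definition hom_group :: "('o, 'm, 'e) precat_scheme \<Rightarrow> 'o \<Rightarrow> 'o \<Rightarrow> 'm monoid" where
  "hom_group C A B = \<lparr>carrier = Hom C A B, mult = plusm C, one = zerom C A B\<rparr>"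

locale basic_category =
  fixes C :: "('o, 'm, 'e) precat_scheme" (structure)
  assumes src_closed: "f \<in> Mor C \<Longrightarrow> src C f \<in> Ob C"
    and tgt_closed: "f \<in> Mor C \<Longrightarrow> tgt C f \<in> Ob C"
    and id_closed: "A \<in> Ob C \<Longrightarrow> idm C A \<in> Hom C A A"
    and comp_closed: "f \<in> Hom C A B \<Longrightarrow> g \<in> Hom C B D \<Longrightarrow> f \<odot> g \<in> Hom C A D"
    and id_left: "f \<in> Hom C A B \<Longrightarrow> idm C A \<odot> f = f"
    and id_right: "f \<in> Hom C A B \<Longrightarrow> f \<odot> idm C B = f"
    and comp_assoc:
      "f \<in> Hom C A B \<Longrightarrow> g \<in> Hom C B D \<Longrightarrow> h \<in> Hom C D E \<Longrightarrow> (f \<odot> g) \<odot> h = f \<odot> (g \<odot> h)"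

locale preadditive_category = basic_category C
  for C :: "('o, 'm, 'e) precat_scheme" (structure) +
  assumes hom_comm_group: "A \<in> Ob C \<Longrightarrow> B \<in> Ob C \<Longrightarrow> comm_group (hom_group C A B)"
    and precomp_hom: "f \<in> Hom C A B \<Longrightarrow> D \<in> Ob C \<Longrightarrow>
      (\<lambda>g. f \<odot> g) \<in> hom (hom_group C B D) (hom_group C A D)"
    and postcomp_hom: "g \<in> Hom C B D \<Longrightarrow> A \<in> Ob C \<Longrightarrow>
      (\<lambda>f. f \<odot> g) \<in> hom (hom_group C A B) (hom_group C A D)"

definition zero_object :: "('o, 'm, 'e) precat_scheme \<Rightarrow> 'o \<Rightarrow> bool" where
  "zero_object C Z \<longleftrightarrow> Z \<in> Ob C \<and>
     (\<forall>A \<in> Ob C. (\<exists>!f. f \<in> Hom C A Z) \<and> (\<exists>!f. f \<in> Hom C Z A))"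

definition biproduct ::
  "('o, 'm, 'e) precat_scheme \<Rightarrow> 'o \<Rightarrow> 'o \<Rightarrow> 'o \<Rightarrow> 'm \<Rightarrow> 'm \<Rightarrow> 'm \<Rightarrow> 'm \<Rightarrow> bool" where
  "biproduct C A B S i j p q \<longleftrightarrow> S \<in> Ob C \<and>
     i \<in> Hom C A S \<and> j \<in> Hom C B S \<and> p \<in> Hom C S A \<and> q \<in> Hom C S B \<and>
     i \<odot>\<^bsub>C\<^esub> p = idm C A \<and> j \<odot>\<^bsub>C\<^esub> q = idm C B \<and>
     i \<odot>\<^bsub>C\<^esub> q = zerom C A B \<and> j \<odot>\<^bsub>C\<^esub> p = zerom C B A \<and>
     (p \<odot>\<^bsub>C\<^esub> i) \<boxplus>\<^bsub>C\<^esub> (q \<odot>\<^bsub>C\<^esub> j) = idm C S"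

locale additive_category = preadditive_category C
  for C :: "('o, 'm, 'e) precat_scheme" (structure) +
  assumes ex_zero_object: "\<exists>Z. zero_object C Z"
    and ex_biproduct: "A \<in> Ob C \<Longrightarrow> B \<in> Ob C \<Longrightarrow> \<exists>S i j p q. biproduct C A B S i j p q"

section \<open>Special morphisms, idempotents, semisimplicity\<close>

definition monomorphism :: "('o, 'm, 'e) precat_scheme \<Rightarrow> 'm \<Rightarrow> bool" where
  "monomorphism C f \<longleftrightarrow> f \<in> Mor C \<and>
     (\<forall>A \<in> Ob C. \<forall>g \<in> Hom C A (src C f). \<forall>h \<in> Hom C A (src C f).
        g \<odot>\<^bsub>C\<^esub> f = h \<odot>\<^bsub>C\<^esub> f \<longrightarrow> g = h)"

definition epimorphism :: "('o, 'm, 'e) precat_scheme \<Rightarrow> 'm \<Rightarrow> bool" where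
  "epimorphism C f \<longleftrightarrow> f \<in> Mor C \<and>
     (\<forall>A \<in> Ob C. \<forall>g \<in> Hom C (tgt C f) A. \<forall>h \<in> Hom C (tgt C f) A.
        f \<odot>\<^bsub>C\<^esub> g = f \<odot>\<^bsub>C\<^esub> h \<longrightarrow> g = h)"

definition split_mono :: "('o, 'm, 'e) precat_scheme \<Rightarrow> 'm \<Rightarrow> bool" where
  "split_mono C i \<longleftrightarrow> i \<in> Mor C \<and>
     (\<exists>r \<in> Hom C (tgt C i) (src C i). i \<odot>\<^bsub>C\<^esub> r = idm C (src C i))"

definition split_epi :: "('o, 'm, 'e) precat_scheme \<Rightarrow> 'm \<Rightarrow> bool" where
  "split_epi C p \<longleftrightarrow> p \<in> Mor C \<and>
     (\<exists>s \<in> Hom C (tgt C p) (src C p). s \<odot>\<^bsub>C\<^esub> p = idm C (tgt C p))"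

definition idempotent_complete :: "('o, 'm, 'e) precat_scheme \<Rightarrow> bool" where
  "idempotent_complete C \<longleftrightarrow>
     (\<forall>A \<in> Ob C. \<forall>e \<in> Hom C A A. e \<odot>\<^bsub>C\<^esub> e = e \<longrightarrow>
        (\<exists>B \<in> Ob C. \<exists>p \<in> Hom C A B. \<exists>i \<in> Hom C B A.
           p \<odot>\<^bsub>C\<^esub> i = e \<and> i \<odot>\<^bsub>C\<^esub> p = idm C B))"

definition semisimple :: "('o, 'm, 'e) precat_scheme \<Rightarrow> bool" where
  "semisimple C \<longleftrightarrow>
     (\<forall>A \<in> Ob C. \<forall>B \<in> Ob C. \<forall>f \<in> Hom C A B.
        \<exists>I \<in> Ob C. \<exists>p \<in> Hom C A I. \<exists>i \<in> Hom C I B.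
          split_epi C p \<and> split_mono C i \<and> f = p \<odot>\<^bsub>C\<^esub> i)"

section \<open>Finite sequences, complexes and null-homotopies\<close>

text \<open>A sequence \<open>X\<^sup>0 \<rightarrow> X\<^sup>1 \<rightarrow> \<dots> \<rightarrow> X\<^sup>m\<close> with \<open>m\<close> morphisms is given by families indexed by all natural
  numbers, of which only \<open>X i\<close> for \<open>i \<le> m\<close> and \<open>d i : X i \<rightarrow> X (i + 1)\<close> for \<open>i < m\<close> matter.\<close>

definition hom_sequence ::
  "('o, 'm, 'e) precat_scheme \<Rightarrow> nat \<Rightarrow> (nat \<Rightarrow> 'o) \<Rightarrow> (nat \<Rightarrow> 'm) \<Rightarrow> bool" where
  "hom_sequence C m X d \<longleftrightarrow>
     (\<forall>i\<le>m. X i \<in> Ob C) \<and> (\<forall>i<m. d i \<in> Hom C (X i) (X (i + 1)))"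

definition complex_sequence ::
  "('o, 'm, 'e) precat_scheme \<Rightarrow> nat \<Rightarrow> (nat \<Rightarrow> 'o) \<Rightarrow> (nat \<Rightarrow> 'm) \<Rightarrow> bool" where
  "complex_sequence C m X d \<longleftrightarrow> hom_sequence C m X d \<and>
     (\<forall>i. i + 1 < m \<longrightarrow> d i \<odot>\<^bsub>C\<^esub> d (i + 1) = zerom C (X i) (X (i + 2)))"

text \<open>A morphism \<open>f\<close> from the complex \<open>(X, d)\<close> to the complex \<open>(Y, e)\<close> is null-homotopic if
  \<open>f\<^sup>i = d\<^sup>i h\<^sup>i\<^sup>+\<^sup>1 + h\<^sup>i e\<^sup>i\<^sup>-\<^sup>1\<close> for some \<open>h\<^sup>i : X\<^sup>i \<rightarrow> Y\<^sup>i\<^sup>-\<^sup>1\<close>. Finite complexes are regarded as extended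
  by zero objects in both directions, so the summands leaving the range \<open>0..m\<close> are zero.\<close>

definition null_homotopic ::
  "('o, 'm, 'e) precat_scheme \<Rightarrow> nat \<Rightarrow> (nat \<Rightarrow> 'o) \<Rightarrow> (nat \<Rightarrow> 'm) \<Rightarrow>
    (nat \<Rightarrow> 'o) \<Rightarrow> (nat \<Rightarrow> 'm) \<Rightarrow> (nat \<Rightarrow> 'm) \<Rightarrow> bool" where
  "null_homotopic C m X d Y e f \<longleftrightarrow>
     (\<exists>h. (\<forall>i. 1 \<le> i \<and> i \<le> m \<longrightarrow> h i \<in> Hom C (X i) (Y (i - 1))) \<and>
          (\<forall>i\<le>m. f i =
             (if i < m then d i \<odot>\<^bsub>C\<^esub> h (i + 1) else zerom C (X i) (Y i)) \<boxplus>\<^bsub>C\<^esub>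
             (if 0 < i then h i \<odot>\<^bsub>C\<^esub> e (i - 1) else zerom C (X i) (Y i))))"

definition contractible ::
  "('o, 'm, 'e) precat_scheme \<Rightarrow> nat \<Rightarrow> (nat \<Rightarrow> 'o) \<Rightarrow> (nat \<Rightarrow> 'm) \<Rightarrow> bool" where
  "contractible C m X d \<longleftrightarrow> complex_sequence C m X d \<and>
     null_homotopic C m X d X d (\<lambda>i. idm C (X i))"

section \<open>n-exact sequences and n-abelian categories\<close>

text \<open>\<open>n_cokernel C n X d\<close> says that \<open>(d\<^sup>1, \<dots>, d\<^sup>n)\<close> is an n-cokernel of \<open>d\<^sup>0\<close>, and
  \<open>n_kernel C n X d\<close> that \<open>(d\<^sup>0, \<dots>, d\<^sup>n\<^sup>-\<^sup>1)\<close> is an n-kernel of \<open>d\<^sup>n\<close>. In both cases the first condition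
  is exactness at the end next to the zero group.\<close>

definition n_cokernel ::
  "('o, 'm, 'e) precat_scheme \<Rightarrow> nat \<Rightarrow> (nat \<Rightarrow> 'o) \<Rightarrow> (nat \<Rightarrow> 'm) \<Rightarrow> bool" where
  "n_cokernel C n X d \<longleftrightarrow> hom_sequence C (n + 1) X d \<and>
     (\<forall>Y \<in> Ob C.
        kernel (hom_group C (X (n + 1)) Y) (hom_group C (X n) Y) (\<lambda>g. d n \<odot>\<^bsub>C\<^esub> g)
          = {zerom C (X (n + 1)) Y} \<and>
        (\<forall>i. 1 \<le> i \<and> i \<le> n \<longrightarrow>
          kernel (hom_group C (X i) Y) (hom_group C (X (i - 1)) Y) (\<lambda>g. d (i - 1) \<odot>\<^bsub>C\<^esub> g)
            = (\<lambda>g. d i \<odot>\<^bsub>C\<^esub> g) ` Hom C (X (i + 1)) Y))"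

definition n_kernel ::
  "('o, 'm, 'e) precat_scheme \<Rightarrow> nat \<Rightarrow> (nat \<Rightarrow> 'o) \<Rightarrow> (nat \<Rightarrow> 'm) \<Rightarrow> bool" where
  "n_kernel C n X d \<longleftrightarrow> hom_sequence C (n + 1) X d \<and>
     (\<forall>Y \<in> Ob C.
        kernel (hom_group C Y (X 0)) (hom_group C Y (X 1)) (\<lambda>g. g \<odot>\<^bsub>C\<^esub> d 0)
          = {zerom C Y (X 0)} \<and>
        (\<forall>i. 1 \<le> i \<and> i \<le> n \<longrightarrow>
          kernel (hom_group C Y (X i)) (hom_group C Y (X (i + 1))) (\<lambda>g. g \<odot>\<^bsub>C\<^esub> d i)
            = (\<lambda>g. g \<odot>\<^bsub>C\<^esub> d (i - 1)) ` Hom C Y (X (i - 1))))"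

definition n_exact ::
  "('o, 'm, 'e) precat_scheme \<Rightarrow> nat \<Rightarrow> (nat \<Rightarrow> 'o) \<Rightarrow> (nat \<Rightarrow> 'm) \<Rightarrow> bool" where
  "n_exact C n X d \<longleftrightarrow>
     complex_sequence C (n + 1) X d \<and> n_kernel C n X d \<and> n_cokernel C n X d"

locale n_abelian_category = additive_category C
  for C :: "('o, 'm, 'e) precat_scheme" (structure) and n :: nat +
  assumes A0: "idempotent_complete C"
    and A1_kernel: "f \<in> Mor C \<Longrightarrow> \<exists>X d. d n = f \<and> n_kernel C n X d"
    and A1_cokernel: "f \<in> Mor C \<Longrightarrow> \<exists>X d. d 0 = f \<and> n_cokernel C n X d"
    and A2: "monomorphism C (d 0) \<Longrightarrow> n_cokernel C n X d \<Longrightarrow> n_exact C n X d"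
    and A2_op: "epimorphism C (d n) \<Longrightarrow> n_kernel C n X d \<Longrightarrow> n_exact C n X d"

end

theory Submission
  imports Defs
begin

text \<open>
  The proof passes through von Neumann regularity: a morphism \<open>f\<close> is regular if \<open>f h f = f\<close> for some
  \<open>h\<close> in the opposite direction. In an idempotent complete category a regular morphism factors
  through the image of the idempotent \<open>f h\<close> as a split epimorphism followed by a split monomorphism,
  so semisimplicity means that idempotents split and that every morphism is regular
  (\<open>semisimple_iff_regular\<close>).

  Suppose that \<open>C\<close> is n-abelian and that n-exact sequences are contractible. A monomorphism starts
  an n-exact sequence, and the contraction of that sequence splits it. Now consider an n-kernel of an
  arbitrary morphism \<open>f\<close>. Its first differential is a monomorphism, hence split, hence regular. If
  one differential is regular, its image is a direct summand, and by exactness the next differential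
  is a monomorphism on the complement; this monomorphism splits, so the next differential is regular
  too (\<open>regular_propagates\<close>). Regularity thus moves along the n-kernel until it reaches \<open>f\<close>.

  Suppose conversely that \<open>C\<close> is semisimple. A regular morphism has a cokernel, a projection onto a
  direct summand, and padding with zero objects turns it into an n-cokernel
  (\<open>regular_ex_n_cokernel\<close>). Regular monomorphisms split. For an n-cokernel of a split monomorphism
  a contraction can be built from left to right, because what the homotopy does not yet account
  for is killed by the previous differential and hence factors through the next one
  (\<open>n_cokernel_contractible\<close>); a contractible complex is in turn an n-kernel
  (\<open>contractible_n_kernel\<close>). This gives axiom (A2) as well as the contractibility of n-exact
  sequences. The axioms about n-kernels and epimorphisms follow by applying the same results to
  the opposite category, which is again additive and semisimple.
\<close>

section \<open>Calculating in preadditive categories\<close>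

context basic_category
begin

lemma Hom_Ob:
  assumes "f \<in> Hom C A B"
  shows "A \<in> Ob C" "B \<in> Ob C"
  using assms src_closed tgt_closed by (auto simp: Hom_def)

lemma Mor_Hom: "f \<in> Mor C \<Longrightarrow> f \<in> Hom C (src C f) (tgt C f)"
  by (simp add: Hom_def)

lemma HomD:
  assumes "f \<in> Hom C A B"
  shows "f \<in> Mor C" "src C f = A" "tgt C f = B"
  using assms by (auto simp: Hom_def)

end

context preadditive_category
begin

lemma zero_closed: "A \<in> Ob C \<Longrightarrow> B \<in> Ob C \<Longrightarrow> zerom C A B \<in> Hom C A B"
  using hom_comm_group[of A B] monoid.one_closed[of "hom_group C A B"]
  by (auto simp: comm_group_def group_def hom_group_def)

lemma plus_closed: "f \<in> Hom C A B \<Longrightarrow> g \<in> Hom C A B \<Longrightarrow> f \<boxplus> g \<in> Hom C A B"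
  using hom_comm_group[of A B] monoid.m_closed[of "hom_group C A B" f g] Hom_Ob[of f A B]
  by (auto simp: comm_group_def group_def hom_group_def)

lemma plus_commute: "f \<in> Hom C A B \<Longrightarrow> g \<in> Hom C A B \<Longrightarrow> f \<boxplus> g = g \<boxplus> f"
  using hom_comm_group[of A B] comm_monoid.m_comm[of "hom_group C A B" f g] Hom_Ob[of f A B]
  by (auto simp: comm_group_def group_def hom_group_def)

lemma zero_plus: "f \<in> Hom C A B \<Longrightarrow> zerom C A B \<boxplus> f = f"
  using hom_comm_group[of A B] monoid.l_one[of "hom_group C A B" f] Hom_Ob[of f A B]
  by (auto simp: comm_group_def group_def hom_group_def)

lemma plus_zero: "f \<in> Hom C A B \<Longrightarrow> f \<boxplus> zerom C A B = f"
  using zero_plus plus_commute zero_closed Hom_Ob by metis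

lemma plus_eq_right_imp_zero:
  assumes "f \<in> Hom C A B" "g \<in> Hom C A B" "f \<boxplus> g = g"
  shows "f = zerom C A B"
proof -
  have "comm_group (hom_group C A B)"
    using hom_comm_group Hom_Ob assms(1) by blast
  then interpret comm_group "hom_group C A B" .
  show ?thesis
    using r_cancel_one[of g f] assms by (simp add: hom_group_def)
qed

lemma ex_difference:
  assumes "f \<in> Hom C A B" "g \<in> Hom C A B"
  shows "\<exists>k \<in> Hom C A B. k \<boxplus> g = f"
proof -
  have "comm_group (hom_group C A B)"
    using hom_comm_group Hom_Ob assms(1) by blast
  then interpret G: comm_group "hom_group C A B" .
  let ?G = "hom_group C A B"
  have f: "f \<in> carrier ?G" and g: "g \<in> carrier ?G"
    using assms by (auto simp: hom_group_def)
  have "f \<otimes>\<^bsub>?G\<^esub> inv\<^bsub>?G\<^esub> g \<otimes>\<^bsub>?G\<^esub> g = f"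
    using G.m_assoc[OF f G.inv_closed[OF g] g] G.l_inv[OF g] G.r_one[OF f] by simp
  moreover have "f \<otimes>\<^bsub>?G\<^esub> inv\<^bsub>?G\<^esub> g \<in> carrier ?G"
    using G.m_closed[OF f G.inv_closed[OF g]] .
  ultimately show ?thesis
    unfolding hom_group_def by auto
qed

lemma comp_plus:
  assumes "f \<in> Hom C A B" "g \<in> Hom C B D" "h \<in> Hom C B D"
  shows "f \<odot> (g \<boxplus> h) = (f \<odot> g) \<boxplus> (f \<odot> h)"
  using precomp_hom[OF assms(1), of D] assms Hom_Ob
  by (auto simp: hom_def hom_group_def)

lemma plus_comp:
  assumes "f \<in> Hom C A B" "g \<in> Hom C A B" "h \<in> Hom C B D"
  shows "(f \<boxplus> g) \<odot> h = (f \<odot> h) \<boxplus> (g \<odot> h)"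
  using postcomp_hom[OF assms(3), of A] assms Hom_Ob
  by (auto simp: hom_def hom_group_def)

lemma comp_zero:
  assumes "f \<in> Hom C A B" "D \<in> Ob C"
  shows "f \<odot> zerom C B D = zerom C A D"
proof (rule plus_eq_right_imp_zero)
  note z = zero_closed[OF Hom_Ob(2)[OF assms(1)] assms(2)]
  show "f \<odot> zerom C B D \<in> Hom C A D" "f \<odot> zerom C B D \<in> Hom C A D"
    using comp_closed[OF assms(1) z] by simp_all
  show "f \<odot> zerom C B D \<boxplus> f \<odot> zerom C B D = f \<odot> zerom C B D"
    using comp_plus[OF assms(1) z z] zero_plus[OF z] by simp
qed

lemma zero_comp:
  assumes "g \<in> Hom C B D" "A \<in> Ob C"
  shows "zerom C A B \<odot> g = zerom C A D"
proof (rule plus_eq_right_imp_zero)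
  note z = zero_closed[OF assms(2) Hom_Ob(1)[OF assms(1)]]
  show "zerom C A B \<odot> g \<in> Hom C A D" "zerom C A B \<odot> g \<in> Hom C A D"
    using comp_closed[OF z assms(1)] by simp_all
  show "zerom C A B \<odot> g \<boxplus> zerom C A B \<odot> g = zerom C A B \<odot> g"
    using plus_comp[OF z z assms(1)] zero_plus[OF z] by simp
qed

text \<open>Additivity reduces cancellability to a statement about zero morphisms.\<close>

lemma monomorphismI:
  assumes f: "f \<in> Hom C A B"
    and zero: "\<And>Y g. g \<in> Hom C Y A \<Longrightarrow> g \<odot> f = zerom C Y B \<Longrightarrow> g = zerom C Y A"
  shows "monomorphism C f"
  unfolding monomorphism_def
proof (intro conjI ballI impI)
  show "f \<in> Mor C" using HomD[OF f] by simp
next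
  fix Y g h
  assume "g \<in> Hom C Y (src C f)" "h \<in> Hom C Y (src C f)" and eq: "g \<odot> f = h \<odot> f"
  then have g: "g \<in> Hom C Y A" and h: "h \<in> Hom C Y A" using HomD[OF f] by auto
  obtain k where k: "k \<in> Hom C Y A" "k \<boxplus> h = g" using ex_difference[OF g h] by blast
  have "k \<odot> f \<boxplus> h \<odot> f = h \<odot> f" using plus_comp[OF k(1) h f] k(2) eq by simp
  then have "k \<odot> f = zerom C Y B"
    using plus_eq_right_imp_zero comp_closed[OF k(1) f] comp_closed[OF h f] by blast
  then have "k = zerom C Y A" using zero[OF k(1)] by simp
  then show "g = h" using k(2) zero_plus[OF h] by simp
qed

end

section \<open>Von Neumann regular morphisms\<close>

definition regular_morphism :: "('o, 'm, 'e) precat_scheme \<Rightarrow> 'm \<Rightarrow> bool" where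
  "regular_morphism C f \<longleftrightarrow> f \<in> Mor C \<and>
     (\<exists>h \<in> Hom C (tgt C f) (src C f). f \<odot>\<^bsub>C\<^esub> h \<odot>\<^bsub>C\<^esub> f = f)"

context preadditive_category
begin

lemma regular_morphismI:
  assumes "f \<in> Hom C A B" "h \<in> Hom C B A" "f \<odot> h \<odot> f = f"
  shows "regular_morphism C f"
  using assms by (auto simp: regular_morphism_def Hom_def)

lemma regular_morphismE:
  assumes "regular_morphism C f" "f \<in> Hom C A B"
  obtains h where "h \<in> Hom C B A" "f \<odot> h \<odot> f = f"
  using assms by (auto simp: regular_morphism_def Hom_def)

lemma split_mono_regular:
  assumes "split_mono C f"
  shows "regular_morphism C f"
  using assms id_left[OF Mor_Hom]
  unfolding split_mono_def regular_morphism_def by metis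

text \<open>If \<open>e\<close> is an idempotent, so is \<open>1 - e\<close>, and splitting the latter gives the complementary
  summand.\<close>

lemma split_complement:
  assumes ic: "idempotent_complete C" and e: "e \<in> Hom C A A" "e \<odot> e = e"
  obtains K q j where "q \<in> Hom C A K" "j \<in> Hom C K A" "j \<odot> q = idm C K"
    "(q \<odot> j) \<boxplus> e = idm C A" "j \<odot> e = zerom C K A" "e \<odot> q = zerom C A K"
proof -
  have A: "A \<in> Ob C" using Hom_Ob[OF e(1)] by simp
  obtain c where c: "c \<in> Hom C A A" "c \<boxplus> e = idm C A"
    using ex_difference[OF id_closed[OF A] e(1)] by blast
  have "(c \<odot> e) \<boxplus> e = e"
    using plus_comp[OF c(1) e(1) e(1)] c(2) e id_left by simp
  then have ce: "c \<odot> e = zerom C A A"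
    using plus_eq_right_imp_zero comp_closed c(1) e(1) by blast
  have "(e \<odot> c) \<boxplus> e = e"
    using comp_plus[OF e(1) c(1) e(1)] c(2) e id_right by simp
  then have ec: "e \<odot> c = zerom C A A"
    using plus_eq_right_imp_zero comp_closed c(1) e(1) by blast
  have "c \<odot> c = (c \<odot> c) \<boxplus> (c \<odot> e)"
    using ce plus_zero[OF comp_closed[OF c(1) c(1)]] by simp
  also have "\<dots> = c"
    using comp_plus[OF c(1) c(1) e(1)] c(2) id_right[OF c(1)] by simp
  finally have "c \<odot> c = c" .
  then obtain K q j where K: "K \<in> Ob C" and q: "q \<in> Hom C A K" and j: "j \<in> Hom C K A"
    and qj: "q \<odot> j = c" and jq: "j \<odot> q = idm C K"
    using ic A c(1) unfolding idempotent_complete_def by blast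
  have jc: "j \<odot> c = j"
    using comp_assoc[OF j q j] id_left[OF j] jq qj by simp
  have cq: "c \<odot> q = q"
    using comp_assoc[OF q j q] id_right[OF q] jq qj by simp
  have "j \<odot> e = zerom C K A"
    using comp_assoc[OF j c(1) e(1)] jc ce comp_zero[OF j A] by simp
  moreover have "e \<odot> q = zerom C A K"
    using comp_assoc[OF e(1) c(1) q] cq ec zero_comp[OF q A] by simp
  ultimately show thesis using that q j jq qj c(2) by blast
qed

text \<open>If \<open>f h f = f\<close>, then \<open>f h\<close> is an idempotent whose image is the image of \<open>f\<close>; conversely, a
  retraction of the mono part followed by a section of the epi part is such an \<open>h\<close>. This replaces
  a condition on factorisations by an equation, which is easier to transport along a complex.\<close>

lemma semisimple_iff_regular:
  "semisimple C \<longleftrightarrow> idempotent_complete C \<and> (\<forall>f \<in> Mor C. regular_morphism C f)"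
proof (intro iffI conjI ballI)
  assume ss: "semisimple C"
  show "idempotent_complete C"
    unfolding idempotent_complete_def
  proof (intro ballI impI)
    fix A e assume A: "A \<in> Ob C" and e: "e \<in> Hom C A A" and ee: "e \<odot> e = e"
    obtain I p i where I: "I \<in> Ob C" and p: "p \<in> Hom C A I" and i: "i \<in> Hom C I A"
      and sp: "split_epi C p" and si: "split_mono C i" and epi: "e = p \<odot> i"
      using ss A e unfolding semisimple_def by blast
    obtain s where s: "s \<in> Hom C I A" "s \<odot> p = idm C I"
      using sp HomD[OF p] unfolding split_epi_def by auto
    obtain r where r: "r \<in> Hom C A I" "i \<odot> r = idm C I"
      using si HomD[OF i] unfolding split_mono_def by auto
    note pi = comp_closed[OF p i] and ip = comp_closed[OF i p]
    \<comment> \<open>Composing \<open>e e = e\<close>, that is \<open>p i p i = p i\<close>, with \<open>s\<close> and \<open>r\<close> cancels the outer factors.\<close>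
    have "i \<odot> p = (s \<odot> p) \<odot> (i \<odot> p) \<odot> (i \<odot> r)"
      using s(2) r(2) id_left[OF ip] id_right[OF ip] by simp
    also have "\<dots> = s \<odot> ((p \<odot> i) \<odot> (p \<odot> i)) \<odot> r"
      using comp_assoc[OF s(1) p ip] comp_assoc[OF p i p] comp_assoc[OF p ip i]
        comp_assoc[OF pi p i] comp_assoc[OF s(1) comp_closed[OF p ip] comp_closed[OF i r(1)]]
        comp_assoc[OF comp_closed[OF p ip] i r(1)]
        comp_assoc[OF s(1) comp_closed[OF pi pi] r(1)]
      by simp
    also have "\<dots> = s \<odot> (p \<odot> i) \<odot> r" using ee epi by simp
    also have "\<dots> = (s \<odot> p) \<odot> (i \<odot> r)"
      using comp_assoc[OF s(1) p i] comp_assoc[OF comp_closed[OF s(1) p] i r(1)] by simp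
    also have "\<dots> = idm C I" using s(2) r(2) id_left[OF id_closed[OF I]] by simp
    finally show "\<exists>B\<in>Ob C. \<exists>p\<in>Hom C A B. \<exists>i\<in>Hom C B A. p \<odot> i = e \<and> i \<odot> p = idm C B"
      using I p i epi by blast
  qed
next
  fix f assume ss: "semisimple C" and "f \<in> Mor C"
  then have f: "f \<in> Hom C (src C f) (tgt C f)" (is "_ \<in> Hom C ?A ?B") by (simp add: Hom_def)
  obtain I p i where I: "I \<in> Ob C" and p: "p \<in> Hom C ?A I" and i: "i \<in> Hom C I ?B"
    and sp: "split_epi C p" and si: "split_mono C i" and fpi: "f = p \<odot> i"
    using ss f Hom_Ob[OF f] unfolding semisimple_def by blast
  obtain s where s: "s \<in> Hom C I ?A" "s \<odot> p = idm C I"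
    using sp HomD[OF p] unfolding split_epi_def by auto
  obtain r where r: "r \<in> Hom C ?B I" "i \<odot> r = idm C I"
    using si HomD[OF i] unfolding split_mono_def by auto
  have "(p \<odot> i) \<odot> (r \<odot> s) = p \<odot> s"
    using comp_assoc[OF p i comp_closed[OF r(1) s(1)]] comp_assoc[OF i r(1) s(1)] r(2)
      id_left[OF s(1)] by simp
  then have "(p \<odot> i) \<odot> (r \<odot> s) \<odot> (p \<odot> i) = p \<odot> i"
    using comp_assoc[OF p s(1) comp_closed[OF p i]] comp_assoc[OF s(1) p i] s(2) id_left[OF i]
    by simp
  then show "regular_morphism C f"
    using regular_morphismI[OF f comp_closed[OF r(1) s(1)]] fpi by simp
next
  assume reg: "idempotent_complete C \<and> (\<forall>f \<in> Mor C. regular_morphism C f)"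
  show "semisimple C"
    unfolding semisimple_def
  proof (intro ballI)
    fix A B f assume A: "A \<in> Ob C" and f: "f \<in> Hom C A B"
    have "regular_morphism C f" using reg HomD(1)[OF f] by blast
    then obtain h where h: "h \<in> Hom C B A" "f \<odot> h \<odot> f = f"
      using regular_morphismE f by blast
    note fh = comp_closed[OF f h(1)]
    have "f \<odot> h \<odot> (f \<odot> h) = f \<odot> h"
      using comp_assoc[OF fh f h(1)] h(2) by simp
    then obtain I p i where I: "I \<in> Ob C" and p: "p \<in> Hom C A I" and i: "i \<in> Hom C I A"
      and pi: "p \<odot> i = f \<odot> h" and ip: "i \<odot> p = idm C I"
      using reg A fh unfolding idempotent_complete_def by blast
    have "p \<odot> (i \<odot> f) = f"
      using comp_assoc[OF p i f] pi h(2) by simp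
    moreover have "i \<odot> f \<odot> (h \<odot> p) = i \<odot> (p \<odot> i) \<odot> p"
      using comp_assoc[OF i f comp_closed[OF h(1) p]] comp_assoc[OF f h(1) p] pi
        comp_assoc[OF i fh p] by simp
    then have "i \<odot> f \<odot> (h \<odot> p) = idm C I"
      using comp_assoc[OF i p i] ip id_left[OF i] by simp
    then have "split_mono C (i \<odot> f)"
      using HomD[OF comp_closed[OF i f]] comp_closed[OF h(1) p]
      unfolding split_mono_def by metis
    moreover have "split_epi C p"
      using HomD[OF p] i ip unfolding split_epi_def by metis
    ultimately show "\<exists>I\<in>Ob C. \<exists>p\<in>Hom C A I. \<exists>i\<in>Hom C I B.
        split_epi C p \<and> split_mono C i \<and> f = p \<odot> i"
      using I p comp_closed[OF i f] by metis
  qed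
qed

text \<open>A regular monomorphism may be cancelled from \<open>f h f = f\<close>.\<close>

lemma regular_mono_split:
  assumes "monomorphism C f" "regular_morphism C f"
  shows "split_mono C f"
proof -
  have f: "f \<in> Hom C (src C f) (tgt C f)"
    using assms(1) by (simp add: monomorphism_def Hom_def)
  obtain h where h: "h \<in> Hom C (tgt C f) (src C f)" "f \<odot> h \<odot> f = f"
    using regular_morphismE assms(2) f by blast
  have "f \<odot> h \<odot> f = idm C (src C f) \<odot> f" using h(2) id_left[OF f] by simp
  then have "f \<odot> h = idm C (src C f)"
    using assms(1) comp_closed[OF f h(1)] id_closed Hom_Ob(1)[OF f]
    unfolding monomorphism_def by blast
  then show ?thesis
    using h(1) HomD(1)[OF f] unfolding split_mono_def by blast
qed

text \<open>The complement of the image of \<open>d\<close> in \<open>Y\<close> is mapped monomorphically by \<open>d'\<close>; splitting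
  this monomorphism gives a quasi-inverse of \<open>d'\<close>.\<close>

lemma regular_propagates:
  assumes ic: "idempotent_complete C"
    and split_monos: "\<And>f. monomorphism C f \<Longrightarrow> split_mono C f"
    and d: "d \<in> Hom C X Y" and d': "d' \<in> Hom C Y Z" and reg: "regular_morphism C d"
    and dd': "d \<odot> d' = zerom C X Z"
    and lift: "\<And>W g. g \<in> Hom C W Y \<Longrightarrow> g \<odot> d' = zerom C W Z \<Longrightarrow> \<exists>k \<in> Hom C W X. g = k \<odot> d"
  shows "regular_morphism C d'"
proof -
  obtain h where h: "h \<in> Hom C Y X" "d \<odot> h \<odot> d = d"
    using regular_morphismE reg d by blast
  define e where "e = h \<odot> d"
  have e: "e \<in> Hom C Y Y" using comp_closed[OF h(1) d] e_def by simp
  have de: "d \<odot> e = d" using comp_assoc[OF d h(1) d] h(2) e_def by simp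
  then have "e \<odot> e = e" using comp_assoc[OF h(1) d e] e_def by simp
  then obtain K q j where q: "q \<in> Hom C Y K" and j: "j \<in> Hom C K Y"
    and jq: "j \<odot> q = idm C K" and qje: "(q \<odot> j) \<boxplus> e = idm C Y" and je: "j \<odot> e = zerom C K Y"
    using split_complement[OF ic e] by metis
  note jd' = comp_closed[OF j d']
  have "monomorphism C (j \<odot> d')"
  proof (rule monomorphismI[OF jd'])
    fix W g assume g: "g \<in> Hom C W K" and 0: "g \<odot> (j \<odot> d') = zerom C W Z"
    have W: "W \<in> Ob C" using Hom_Ob[OF g] by simp
    have "g \<odot> j \<odot> d' = zerom C W Z" using comp_assoc[OF g j d'] 0 by simp
    then obtain k where k: "k \<in> Hom C W X" "g \<odot> j = k \<odot> d"
      using lift[OF comp_closed[OF g j]] by blast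
    have "g \<odot> j = g \<odot> j \<odot> e" using comp_assoc[OF k(1) d e] de k(2) by simp
    also have "\<dots> = zerom C W Y"
      using comp_assoc[OF g j e] je comp_zero[OF g] Hom_Ob(2)[OF e] by simp
    finally have "g \<odot> j \<odot> q = zerom C W K" using zero_comp[OF q W] by simp
    then show "g = zerom C W K" using comp_assoc[OF g j q] jq id_right[OF g] by simp
  qed
  then obtain r where r: "r \<in> Hom C Z K" "j \<odot> d' \<odot> r = idm C K"
    using split_monos HomD[OF jd'] unfolding split_mono_def by metis
  have "e \<odot> d' = zerom C Y Z"
    using comp_assoc[OF h(1) d d'] dd' comp_zero[OF h(1)] Hom_Ob(2)[OF d'] e_def by simp
  then have d'_eq: "q \<odot> (j \<odot> d') = d'"
    using plus_comp[OF comp_closed[OF q j] e d'] qje id_left[OF d']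
      plus_zero[OF comp_closed[OF comp_closed[OF q j] d']] comp_assoc[OF q j d'] by simp
  have "d' \<odot> r = q"
    using comp_assoc[OF q jd' r(1)] d'_eq r(2) id_right[OF q] by simp
  then have "d' \<odot> (r \<odot> j) \<odot> d' = d'"
    using comp_assoc[OF d' r(1) j] comp_assoc[OF q j d'] d'_eq by simp
  then show ?thesis using regular_morphismI[OF d' comp_closed[OF r(1) j]] by simp
qed

end

section \<open>Exactness in terms of elements\<close>

context preadditive_category
begin

lemma kernel_precomp:
  "kernel (hom_group C B Y) (hom_group C A Y) (\<lambda>g. f \<odot> g)
    = {g \<in> Hom C B Y. f \<odot> g = zerom C A Y}"
  by (simp add: kernel_def hom_group_def)

lemma kernel_postcomp:
  "kernel (hom_group C Y A) (hom_group C Y B) (\<lambda>g. g \<odot> f)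
    = {g \<in> Hom C Y A. g \<odot> f = zerom C Y B}"
  by (simp add: kernel_def hom_group_def)

lemma hom_sequenceD:
  assumes "hom_sequence C m X d"
  shows "i \<le> m \<Longrightarrow> X i \<in> Ob C" "i < m \<Longrightarrow> d i \<in> Hom C (X i) (X (Suc i))"
  using assms by (auto simp: hom_sequence_def)

text \<open>That consecutive differentials compose to zero is part of exactness: \<open>d\<^sup>i\<^sup>+\<^sup>1\<close> is the image of an
  identity under precomposition with \<open>d\<^sup>i\<^sup>+\<^sup>1\<close>, so it lies in the kernel of precomposition with \<open>d\<^sup>i\<close>.
  Indices are shifted so that no predecessors occur.\<close>

lemma n_cokernel_iff:
  "n_cokernel C n X d \<longleftrightarrow> complex_sequence C (n + 1) X d \<and>
     (\<forall>Y. \<forall>g \<in> Hom C (X (n + 1)) Y. d n \<odot> g = zerom C (X n) Y \<longrightarrow> g = zerom C (X (n + 1)) Y) \<and>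
     (\<forall>i<n. \<forall>Y. \<forall>g \<in> Hom C (X (i + 1)) Y. d i \<odot> g = zerom C (X i) Y \<longrightarrow>
        (\<exists>k \<in> Hom C (X (i + 2)) Y. g = d (i + 1) \<odot> k))"
  (is "_ \<longleftrightarrow> _ \<and> ?last \<and> ?inner")
proof (intro iffI conjI)
  assume nc: "n_cokernel C n X d"
  then have hs: "hom_sequence C (n + 1) X d"
    by (simp add: n_cokernel_def)
  have im: "{g \<in> Hom C (X (i + 1)) Y. d i \<odot> g = zerom C (X i) Y}
      = (\<lambda>g. d (i + 1) \<odot> g) ` Hom C (X (i + 2)) Y" if "i < n" "Y \<in> Ob C" for i Y
  proof -
    have "\<forall>j. 1 \<le> j \<and> j \<le> n \<longrightarrow> {g \<in> Hom C (X j) Y. d (j - 1) \<odot> g = zerom C (X (j - 1)) Y}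
      = (\<lambda>g. d j \<odot> g) ` Hom C (X (j + 1)) Y"
      using nc that(2) unfolding n_cokernel_def kernel_precomp by blast
    from this[rule_format, of "i + 1"] show ?thesis
      using that(1) by simp
  qed
  show "complex_sequence C (n + 1) X d"
    unfolding complex_sequence_def
  proof (intro conjI allI impI hs)
    fix i assume i: "i + 1 < n + 1"
    have X: "X (i + 2) \<in> Ob C" and d: "d (i + 1) \<in> Hom C (X (i + 1)) (X (i + 2))"
      using hom_sequenceD[OF hs, of "i + 2"] hom_sequenceD[OF hs, of "i + 1"] i by auto
    have "d (i + 1) \<odot> idm C (X (i + 2)) \<in> (\<lambda>g. d (i + 1) \<odot> g) ` Hom C (X (i + 2)) (X (i + 2))"
      using id_closed[OF X] by blast
    then show "d i \<odot> d (i + 1) = zerom C (X i) (X (i + 2))"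
      using im[OF _ X] i id_right[OF d] by auto
  qed
  show ?inner
    using im Hom_Ob by blast
  have "{g \<in> Hom C (X (n + 1)) Y. d n \<odot> g = zerom C (X n) Y} = {zerom C (X (n + 1)) Y}"
    if "Y \<in> Ob C" for Y
    using nc that unfolding n_cokernel_def kernel_precomp by blast
  then show ?last
    using Hom_Ob by blast
next
  assume R: "complex_sequence C (n + 1) X d \<and> ?last \<and> ?inner"
  then have hs: "hom_sequence C (n + 1) X d"
    by (simp add: complex_sequence_def)
  show "n_cokernel C n X d"
    unfolding n_cokernel_def kernel_precomp
  proof (intro conjI ballI allI impI hs)
    fix Y assume Y: "Y \<in> Ob C"
    have "zerom C (X (n + 1)) Y \<in> Hom C (X (n + 1)) Y"
      using zero_closed hom_sequenceD[OF hs] Y by simp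
    moreover have "d n \<odot> zerom C (X (n + 1)) Y = zerom C (X n) Y"
      using comp_zero[OF hom_sequenceD(2)[OF hs] Y, of n] by simp
    ultimately show "{g \<in> Hom C (X (n + 1)) Y. d n \<odot> g = zerom C (X n) Y} = {zerom C (X (n + 1)) Y}"
      using R by blast
  next
    fix Y i assume Y: "Y \<in> Ob C" and i: "1 \<le> i \<and> i \<le> n"
    then obtain k where k: "i = k + 1" "k < n" by (metis add.commute le_Suc_ex less_eq_Suc_le plus_1_eq_Suc)
    have d: "d k \<in> Hom C (X k) (X (k + 1))" "d (k + 1) \<in> Hom C (X (k + 1)) (X (k + 2))"
      using hom_sequenceD(2)[OF hs, of k] hom_sequenceD(2)[OF hs, of "k + 1"] k by auto
    have dd: "d k \<odot> d (k + 1) = zerom C (X k) (X (k + 2))"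
      using R k unfolding complex_sequence_def by auto
    have "d k \<odot> (d (k + 1) \<odot> g) = zerom C (X k) Y" if "g \<in> Hom C (X (k + 2)) Y" for g
      using comp_assoc[OF d that] dd zero_comp[OF that Hom_Ob(1)[OF d(1)]] by simp
    then have "{g \<in> Hom C (X (k + 1)) Y. d k \<odot> g = zerom C (X k) Y}
        = (\<lambda>g. d (k + 1) \<odot> g) ` Hom C (X (k + 2)) Y"
      using R k comp_closed[OF d(2)] by blast
    then show "{g \<in> Hom C (X i) Y. d (i - 1) \<odot> g = zerom C (X (i - 1)) Y}
        = (\<lambda>g. d i \<odot> g) ` Hom C (X (i + 1)) Y"
      using k by simp
  qed
qed

lemma n_kernel_iff:
  "n_kernel C n X d \<longleftrightarrow> complex_sequence C (n + 1) X d \<and>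
     (\<forall>Y. \<forall>g \<in> Hom C Y (X 0). g \<odot> d 0 = zerom C Y (X 1) \<longrightarrow> g = zerom C Y (X 0)) \<and>
     (\<forall>i<n. \<forall>Y. \<forall>g \<in> Hom C Y (X (i + 1)). g \<odot> d (i + 1) = zerom C Y (X (i + 2)) \<longrightarrow>
        (\<exists>k \<in> Hom C Y (X i). g = k \<odot> d i))"
  (is "_ \<longleftrightarrow> _ \<and> ?first \<and> ?inner")
proof (intro iffI conjI)
  assume nc: "n_kernel C n X d"
  then have hs: "hom_sequence C (n + 1) X d"
    by (simp add: n_kernel_def)
  have im: "{g \<in> Hom C Y (X (i + 1)). g \<odot> d (i + 1) = zerom C Y (X (i + 2))}
      = (\<lambda>g. g \<odot> d i) ` Hom C Y (X i)" if "i < n" "Y \<in> Ob C" for i Y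
  proof -
    have "\<forall>j. 1 \<le> j \<and> j \<le> n \<longrightarrow> {g \<in> Hom C Y (X j). g \<odot> d j = zerom C Y (X (j + 1))}
      = (\<lambda>g. g \<odot> d (j - 1)) ` Hom C Y (X (j - 1))"
      using nc that(2) unfolding n_kernel_def kernel_postcomp by blast
    from this[rule_format, of "i + 1"] show ?thesis
      using that(1) by simp
  qed
  show "complex_sequence C (n + 1) X d"
    unfolding complex_sequence_def
  proof (intro conjI allI impI hs)
    fix i assume i: "i + 1 < n + 1"
    have X: "X i \<in> Ob C" and d: "d i \<in> Hom C (X i) (X (i + 1))"
      using hom_sequenceD[OF hs, of i] i by auto
    have "idm C (X i) \<odot> d i \<in> (\<lambda>g. g \<odot> d i) ` Hom C (X i) (X i)"
      using id_closed[OF X] by blast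
    then show "d i \<odot> d (i + 1) = zerom C (X i) (X (i + 2))"
      using im[OF _ X] i id_left[OF d] by auto
  qed
  show ?inner
    using im Hom_Ob by blast
  have "{g \<in> Hom C Y (X 0). g \<odot> d 0 = zerom C Y (X 1)} = {zerom C Y (X 0)}"
    if "Y \<in> Ob C" for Y
    using nc that unfolding n_kernel_def kernel_postcomp by blast
  then show ?first
    using Hom_Ob by blast
next
  assume R: "complex_sequence C (n + 1) X d \<and> ?first \<and> ?inner"
  then have hs: "hom_sequence C (n + 1) X d"
    by (simp add: complex_sequence_def)
  show "n_kernel C n X d"
    unfolding n_kernel_def kernel_postcomp
  proof (intro conjI ballI allI impI hs)
    fix Y assume Y: "Y \<in> Ob C"
    have "zerom C Y (X 0) \<in> Hom C Y (X 0)"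
      using zero_closed hom_sequenceD[OF hs] Y by simp
    moreover have "zerom C Y (X 0) \<odot> d 0 = zerom C Y (X 1)"
      using zero_comp[OF hom_sequenceD(2)[OF hs] Y, of 0] by simp
    ultimately show "{g \<in> Hom C Y (X 0). g \<odot> d 0 = zerom C Y (X 1)} = {zerom C Y (X 0)}"
      using R by blast
  next
    fix Y i assume Y: "Y \<in> Ob C" and i: "1 \<le> i \<and> i \<le> n"
    then obtain k where k: "i = k + 1" "k < n" by (metis add.commute le_Suc_ex less_eq_Suc_le plus_1_eq_Suc)
    have d: "d k \<in> Hom C (X k) (X (k + 1))" "d (k + 1) \<in> Hom C (X (k + 1)) (X (k + 2))"
      using hom_sequenceD(2)[OF hs, of k] hom_sequenceD(2)[OF hs, of "k + 1"] k by auto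
    have dd: "d k \<odot> d (k + 1) = zerom C (X k) (X (k + 2))"
      using R k unfolding complex_sequence_def by auto
    have "g \<odot> d k \<odot> d (k + 1) = zerom C Y (X (k + 2))" if "g \<in> Hom C Y (X k)" for g
      using comp_assoc[OF that d] dd comp_zero[OF that Hom_Ob(2)[OF d(2)]] by simp
    then have "{g \<in> Hom C Y (X (k + 1)). g \<odot> d (k + 1) = zerom C Y (X (k + 2))}
        = (\<lambda>g. g \<odot> d k) ` Hom C Y (X k)"
      using R k comp_closed[OF _ d(1)] by blast
    then show "{g \<in> Hom C Y (X i). g \<odot> d i = zerom C Y (X (i + 1))}
        = (\<lambda>g. g \<odot> d (i - 1)) ` Hom C Y (X (i - 1))"
      using k by simp
  qed
qed

end

section \<open>The opposite category\<close>

definition opposite :: "('o, 'm, 'e) precat_scheme \<Rightarrow> ('o, 'm, 'e) precat_scheme" where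
  "opposite C = C\<lparr>src := tgt C, tgt := src C, cmp := \<lambda>f g. g \<odot>\<^bsub>C\<^esub> f, zerom := \<lambda>A B. zerom C B A\<rparr>"

lemma opposite_simps [simp]:
  "Ob (opposite C) = Ob C" "Mor (opposite C) = Mor C" "src (opposite C) = tgt C"
  "tgt (opposite C) = src C" "idm (opposite C) = idm C"
  "f \<odot>\<^bsub>opposite C\<^esub> g = g \<odot>\<^bsub>C\<^esub> f" "plusm (opposite C) = plusm C"
  "zerom (opposite C) A B = zerom C B A"
  "Hom (opposite C) A B = Hom C B A"
  "hom_group (opposite C) A B = hom_group C B A"
  by (auto simp: opposite_def Hom_def hom_group_def)

lemma opposite_opposite [simp]: "opposite (opposite C) = C"
  by (simp add: opposite_def)

lemma monomorphism_opposite [simp]: "monomorphism (opposite C) f \<longleftrightarrow> epimorphism C f"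
  by (simp add: monomorphism_def epimorphism_def)

lemma regular_morphism_opposite:
  assumes "basic_category C" "regular_morphism C f"
  shows "regular_morphism (opposite C) f"
proof -
  interpret basic_category C by fact
  have f: "f \<in> Hom C (src C f) (tgt C f)"
    using assms(2) by (simp add: regular_morphism_def Hom_def)
  show ?thesis
    using assms(2) comp_assoc[OF f _ f]
    by (auto simp: regular_morphism_def)
qed

lemma idempotent_complete_opposite:
  "idempotent_complete C \<Longrightarrow> idempotent_complete (opposite C)"
  unfolding idempotent_complete_def by (simp, blast)

lemma preadditive_category_opposite:
  assumes "preadditive_category C"
  shows "preadditive_category (opposite C)"
proof -
  interpret preadditive_category C by fact
  show ?thesis
    by (intro preadditive_category.intro basic_category.intro preadditive_category_axioms.intro)
      (auto simp: src_closed tgt_closed id_closed comp_closed id_left id_right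
        comp_assoc hom_comm_group precomp_hom postcomp_hom)
qed

lemma additive_category_opposite:
  assumes "additive_category C"
  shows "additive_category (opposite C)"
proof -
  interpret additive_category C by fact
  interpret opp: preadditive_category "opposite C"
    by (rule preadditive_category_opposite) unfold_locales
  show ?thesis
  proof
    show "\<exists>Z. zero_object (opposite C) Z"
      using ex_zero_object by (simp add: zero_object_def conj_commute)
  next
    fix A B assume "A \<in> Ob (opposite C)" "B \<in> Ob (opposite C)"
    then obtain S i j p q where "biproduct C A B S i j p q"
      using ex_biproduct[of A B] unfolding opposite_simps by blast
    then have "biproduct (opposite C) A B S p q i j"
      by (simp add: biproduct_def)
    then show "\<exists>S i j p q. biproduct (opposite C) A B S i j p q" by blast
  qed
qed

lemma semisimple_opposite:
  assumes "preadditive_category C" "semisimple C"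
  shows "semisimple (opposite C)"
proof -
  interpret preadditive_category C by fact
  interpret opp: preadditive_category "opposite C"
    by (rule preadditive_category_opposite) fact
  show ?thesis
    using assms(2) regular_morphism_opposite[OF basic_category_axioms]
      idempotent_complete_opposite[of C]
    unfolding semisimple_iff_regular opp.semisimple_iff_regular opposite_simps by blast
qed

text \<open>Only the indices up to \<open>n + 1\<close> matter for sequences, so reversal is a relation; as such it is
  symmetric, which a reversal function on families indexed by all natural numbers is not.\<close>

definition reversed ::
  "nat \<Rightarrow> (nat \<Rightarrow> 'o) \<Rightarrow> (nat \<Rightarrow> 'm) \<Rightarrow> (nat \<Rightarrow> 'o) \<Rightarrow> (nat \<Rightarrow> 'm) \<Rightarrow> bool" where
  "reversed n X d X' d' \<longleftrightarrow> (\<forall>i\<le>n + 1. X' i = X (n + 1 - i)) \<and> (\<forall>i\<le>n. d' i = d (n - i))"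

lemma reversed_sym: "reversed n X d X' d' \<Longrightarrow> reversed n X' d' X d"
  by (auto simp: reversed_def)

lemma ex_reversed: "\<exists>X' d'. reversed n X d X' d'"
  by (intro exI[of _ "\<lambda>i. X (n + 1 - i)"] exI[of _ "\<lambda>i. d (n - i)"]) (simp add: reversed_def)

lemma complex_sequence_reversed:
  assumes rev: "reversed n X d X' d'" and cs: "complex_sequence C (n + 1) X d"
  shows "complex_sequence (opposite C) (n + 1) X' d'"
proof -
  have X': "X' i = X (n + 1 - i)" if "i \<le> n + 1" for i using rev that by (simp add: reversed_def)
  have d': "d' i = d (n - i)" if "i \<le> n" for i using rev that by (simp add: reversed_def)
  have hs: "\<And>i. i \<le> n + 1 \<Longrightarrow> X i \<in> Ob C" "\<And>i. i \<le> n \<Longrightarrow> d i \<in> Hom C (X i) (X (i + 1))"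
    and dd: "\<And>i. i < n \<Longrightarrow> d i \<odot>\<^bsub>C\<^esub> d (i + 1) = zerom C (X i) (X (i + 2))"
    using cs by (auto simp: complex_sequence_def hom_sequence_def)
  show ?thesis
    unfolding complex_sequence_def hom_sequence_def
  proof (intro conjI allI impI)
    fix i assume "i \<le> n + 1"
    then show "X' i \<in> Ob (opposite C)" using hs X' by simp
  next
    fix i assume "i < n + 1"
    then show "d' i \<in> Hom (opposite C) (X' i) (X' (i + 1))"
      using hs(2)[of "n - i"] X'[of i] X'[of "i + 1"] d'[of i] by (simp add: Suc_diff_le)
  next
    fix i assume i: "i + 1 < n + 1"
    then obtain k where k: "n = i + k + 1" using less_imp_Suc_add[of i n] by auto
    have "d' i = d (k + 1)" "d' (i + 1) = d k" "X' i = X (k + 2)" "X' (i + 2) = X k"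
      using d'[of i] d'[of "i + 1"] X'[of i] X'[of "i + 2"] k by auto
    then show "d' i \<odot>\<^bsub>opposite C\<^esub> d' (i + 1) = zerom (opposite C) (X' i) (X' (i + 2))"
      using dd[of k] k by simp
  qed
qed

lemma n_kernel_reversed:
  assumes "preadditive_category C" and rev: "reversed n X d X' d'"
    and nk: "n_kernel C n X d"
  shows "n_cokernel (opposite C) n X' d'"
proof -
  interpret preadditive_category C by fact
  interpret opp: preadditive_category "opposite C"
    by (rule preadditive_category_opposite) fact
  have X': "X' i = X (n + 1 - i)" if "i \<le> n + 1" for i using rev that by (simp add: reversed_def)
  have d': "d' i = d (n - i)" if "i \<le> n" for i using rev that by (simp add: reversed_def)
  show ?thesis
    unfolding opp.n_cokernel_iff
  proof (intro conjI allI impI ballI)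
    show "complex_sequence (opposite C) (n + 1) X' d'"
      using complex_sequence_reversed[OF rev] nk n_kernel_iff by blast
  next
    fix Y g
    assume "g \<in> Hom (opposite C) (X' (n + 1)) Y"
      "d' n \<odot>\<^bsub>opposite C\<^esub> g = zerom (opposite C) (X' n) Y"
    then show "g = zerom (opposite C) (X' (n + 1)) Y"
      using nk d'[of n] X'[of n] X'[of "n + 1"] by (simp add: n_kernel_iff)
  next
    fix i Y g
    assume i: "i < n" and g: "g \<in> Hom (opposite C) (X' (i + 1)) Y"
      "d' i \<odot>\<^bsub>opposite C\<^esub> g = zerom (opposite C) (X' i) Y"
    obtain k where k: "n = i + k + 1" using i less_imp_Suc_add[of i n] by auto
    have "d' i = d (k + 1)" "d' (i + 1) = d k" "X' i = X (k + 2)" "X' (i + 1) = X (k + 1)"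
      "X' (i + 2) = X k"
      using d'[of i] d'[of "i + 1"] X'[of i] X'[of "i + 1"] X'[of "i + 2"] k by auto
    then show "\<exists>k\<in>Hom (opposite C) (X' (i + 2)) Y. g = d' (i + 1) \<odot>\<^bsub>opposite C\<^esub> k"
      using nk g k by (simp add: n_kernel_iff)
  qed
qed

lemma n_cokernel_reversed:
  assumes "preadditive_category C" and rev: "reversed n X d X' d'"
    and nc: "n_cokernel C n X d"
  shows "n_kernel (opposite C) n X' d'"
proof -
  interpret preadditive_category C by fact
  interpret opp: preadditive_category "opposite C"
    by (rule preadditive_category_opposite) fact
  have X': "X' i = X (n + 1 - i)" if "i \<le> n + 1" for i using rev that by (simp add: reversed_def)
  have d': "d' i = d (n - i)" if "i \<le> n" for i using rev that by (simp add: reversed_def)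
  show ?thesis
    unfolding opp.n_kernel_iff
  proof (intro conjI allI impI ballI)
    show "complex_sequence (opposite C) (n + 1) X' d'"
      using complex_sequence_reversed[OF rev] nc n_cokernel_iff by blast
  next
    fix Y g
    assume "g \<in> Hom (opposite C) Y (X' 0)"
      "g \<odot>\<^bsub>opposite C\<^esub> d' 0 = zerom (opposite C) Y (X' 1)"
    then show "g = zerom (opposite C) Y (X' 0)"
      using nc d'[of 0] X'[of 0] X'[of 1] by (simp add: n_cokernel_iff)
  next
    fix i Y g
    assume i: "i < n" and g: "g \<in> Hom (opposite C) Y (X' (i + 1))"
      "g \<odot>\<^bsub>opposite C\<^esub> d' (i + 1) = zerom (opposite C) Y (X' (i + 2))"
    obtain k where k: "n = i + k + 1" using i less_imp_Suc_add[of i n] by auto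
    have "d' i = d (k + 1)" "d' (i + 1) = d k" "X' i = X (k + 2)" "X' (i + 1) = X (k + 1)"
      "X' (i + 2) = X k"
      using d'[of i] d'[of "i + 1"] X'[of i] X'[of "i + 1"] X'[of "i + 2"] k by auto
    then show "\<exists>k\<in>Hom (opposite C) Y (X' i). g = k \<odot>\<^bsub>opposite C\<^esub> d' i"
      using nc g k by (simp add: n_cokernel_iff)
  qed
qed

lemma n_exact_reversed:
  assumes "preadditive_category C" "reversed n X d X' d'" "n_exact C n X d"
  shows "n_exact (opposite C) n X' d'"
  using assms complex_sequence_reversed n_kernel_reversed n_cokernel_reversed
  unfolding n_exact_def by blast

section \<open>Contractions and exactness\<close>

context preadditive_category
begin

text \<open>The homotopy is built by recursion. The recursion invariant is not the homotopy equation but its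
  consequence that the homotopy is a quasi-inverse of the differential: this is just what makes the
  difference between the identity and \<open>h d\<close> vanish after precomposition with \<open>d\<close>, so that the
  n-cokernel property provides the next component. At the last object the difference is zero,
  since there precomposition with the last differential is injective.\<close>

lemma n_cokernel_contractible:
  assumes nc: "n_cokernel C n X d" and split: "split_mono C (d 0)"
  shows "contractible C (n + 1) X d"
proof -
  have cs: "complex_sequence C (n + 1) X d"
    and last: "\<And>Y g. g \<in> Hom C (X (n + 1)) Y \<Longrightarrow> d n \<odot> g = zerom C (X n) Y \<Longrightarrow>
      g = zerom C (X (n + 1)) Y"
    and inner: "\<And>i Y g. i < n \<Longrightarrow> g \<in> Hom C (X (i + 1)) Y \<Longrightarrow> d i \<odot> g = zerom C (X i) Y \<Longrightarrow>
      \<exists>k \<in> Hom C (X (i + 2)) Y. g = d (i + 1) \<odot> k"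
    using nc unfolding n_cokernel_iff by blast+
  have X: "X i \<in> Ob C" if "i \<le> n + 1" for i
    using cs that by (simp add: complex_sequence_def hom_sequence_def)
  have d: "d i \<in> Hom C (X i) (X (i + 1))" if "i \<le> n" for i
    using cs that by (simp add: complex_sequence_def hom_sequence_def)
  have dd: "d i \<odot> d (i + 1) = zerom C (X i) (X (i + 2))" if "i < n" for i
    using cs that by (simp add: complex_sequence_def)
  have rest: "\<exists>c \<in> Hom C (X (i + 1)) (X (i + 1)).
      c \<boxplus> (x \<odot> d i) = idm C (X (i + 1)) \<and> d i \<odot> c = zerom C (X i) (X (i + 1))"
    if i: "i \<le> n" and x: "x \<in> Hom C (X (i + 1)) (X i)" and dxd: "d i \<odot> x \<odot> d i = d i" for i x
  proof -
    note xd = comp_closed[OF x d[OF i]]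
    obtain c where c: "c \<in> Hom C (X (i + 1)) (X (i + 1))" "c \<boxplus> (x \<odot> d i) = idm C (X (i + 1))"
      using ex_difference[OF id_closed xd] X[of "i + 1"] i by auto
    have "(d i \<odot> c) \<boxplus> d i = d i"
      using comp_plus[OF d[OF i] c(1) xd] c(2) id_right[OF d[OF i]]
        comp_assoc[OF d[OF i] x d[OF i]] dxd by simp
    then have "d i \<odot> c = zerom C (X i) (X (i + 1))"
      using plus_eq_right_imp_zero comp_closed[OF d[OF i] c(1)] d[OF i] by blast
    then show ?thesis using c by blast
  qed
  \<comment> \<open>Here \<open>x\<close> at index \<open>i\<close> is the homotopy component \<open>h\<^sup>i\<^sup>+\<^sup>1\<close>, since there is no component \<open>h\<^sup>0\<close>.\<close>
  define P where "P i x \<longleftrightarrow> (i \<le> n \<longrightarrow> x \<in> Hom C (X (i + 1)) (X i) \<and> d i \<odot> x \<odot> d i = d i) \<and>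
    (i = 0 \<longrightarrow> d 0 \<odot> x = idm C (X 0))" for i x
  define Q where "Q i x y \<longleftrightarrow> (i < n \<longrightarrow> (d (i + 1) \<odot> y) \<boxplus> (x \<odot> d i) = idm C (X (i + 1)))" for i x y
  obtain r where r: "r \<in> Hom C (X 1) (X 0)" "d 0 \<odot> r = idm C (X 0)"
    using split HomD[OF d[of 0]] unfolding split_mono_def by auto
  have start: "\<exists>x. P 0 x" using r id_left[OF d[of 0]] by (auto simp: P_def)
  have step: "\<exists>y. P (Suc i) y \<and> Q i x y" if "P i x" for i x
  proof (cases "i < n")
    case True
    then have x: "x \<in> Hom C (X (i + 1)) (X i)" "d i \<odot> x \<odot> d i = d i"
      using \<open>P i x\<close> by (auto simp: P_def)
    have di: "d i \<in> Hom C (X i) (X (i + 1))" and di': "d (i + 1) \<in> Hom C (X (i + 1)) (X (i + 2))"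
      using d[of i] d[of "i + 1"] True by auto
    obtain c where c: "c \<in> Hom C (X (i + 1)) (X (i + 1))" "c \<boxplus> (x \<odot> d i) = idm C (X (i + 1))"
      "d i \<odot> c = zerom C (X i) (X (i + 1))"
      using rest[OF _ x] True by auto
    obtain y where y: "y \<in> Hom C (X (i + 2)) (X (i + 1))" "c = d (i + 1) \<odot> y"
      using inner[OF True c(1,3)] by blast
    have "x \<odot> d i \<odot> d (i + 1) = zerom C (X (i + 1)) (X (i + 2))"
      using comp_assoc[OF x(1) di di'] dd[OF True] comp_zero[OF x(1) Hom_Ob(2)[OF di']] by simp
    then have "c \<odot> d (i + 1) = d (i + 1)"
      using plus_comp[OF c(1) comp_closed[OF x(1) di] di'] c(2) id_left[OF di']
        plus_zero[OF comp_closed[OF c(1) di']] by simp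
    then have "P (Suc i) y \<and> Q i x y"
      using y c(2) by (simp add: P_def Q_def)
    then show ?thesis by blast
  next
    case False
    then show ?thesis by (simp add: P_def Q_def)
  qed
  obtain H where H: "\<And>i. P i (H i)" "\<And>i. Q i (H i) (H (Suc i))"
    using dependent_nat_choice[of P Q, OF start step] by blast
  have H_Hom: "H i \<in> Hom C (X (i + 1)) (X i)" if "i \<le> n" for i
    using H(1)[of i] that by (simp add: P_def)
  have H0: "d 0 \<odot> H 0 = idm C (X 0)"
    using H(1)[of 0] by (simp add: P_def)
  have Hn: "H n \<odot> d n = idm C (X (n + 1))"
  proof -
    have x: "H n \<in> Hom C (X (n + 1)) (X n)" "d n \<odot> H n \<odot> d n = d n"
      using H(1)[of n] by (auto simp: P_def)
    obtain c where c: "c \<in> Hom C (X (n + 1)) (X (n + 1))" "c \<boxplus> (H n \<odot> d n) = idm C (X (n + 1))"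
      "d n \<odot> c = zerom C (X n) (X (n + 1))"
      using rest[OF _ x] by auto
    then show ?thesis
      using last[OF c(1,3)] zero_plus[OF comp_closed[OF x(1) d[of n]]] by simp
  qed
  have "idm C (X i) = (if i < n + 1 then d i \<odot> H i else zerom C (X i) (X i)) \<boxplus>
      (if 0 < i then H (i - 1) \<odot> d (i - 1) else zerom C (X i) (X i))" if i: "i \<le> n + 1" for i
  proof -
    consider "i = 0" | "0 < i" "i < n + 1" | "i = n + 1"
      using i by linarith
    then show ?thesis
    proof cases
      case 1
      then show ?thesis using H0 plus_zero[OF id_closed] X[of 0] by simp
    next
      case 2
      then show ?thesis using H(2)[of "i - 1"] by (simp add: Q_def)
    next
      case 3
      then show ?thesis using Hn zero_plus[OF id_closed] X[of "n + 1"] by simp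
    qed
  qed
  moreover have "H (i - 1) \<in> Hom C (X i) (X (i - 1))" if "1 \<le> i \<and> i \<le> n + 1" for i
    using H_Hom[of "i - 1"] that by auto
  ultimately have "null_homotopic C (n + 1) X d X d (\<lambda>i. idm C (X i))"
    unfolding null_homotopic_def
    by (intro exI[of _ "\<lambda>i. H (i - 1)"]) simp
  then show ?thesis
    using cs by (simp add: contractible_def)
qed

lemma contractible_split_mono:
  assumes "contractible C (n + 1) X d"
  shows "split_mono C (d 0)"
proof -
  have X: "X 0 \<in> Ob C" and d: "d 0 \<in> Hom C (X 0) (X 1)"
    using assms by (auto simp: contractible_def complex_sequence_def hom_sequence_def)
  obtain h where h: "\<forall>i. 1 \<le> i \<and> i \<le> n + 1 \<longrightarrow> h i \<in> Hom C (X i) (X (i - 1))"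
    and eq: "\<forall>i\<le>n + 1. idm C (X i) =
             (if i < n + 1 then d i \<odot> h (i + 1) else zerom C (X i) (X i)) \<boxplus>
             (if 0 < i then h i \<odot> d (i - 1) else zerom C (X i) (X i))"
    using assms unfolding contractible_def null_homotopic_def by blast
  have h1: "h 1 \<in> Hom C (X 1) (X 0)" using h[rule_format, of 1] by simp
  have "d 0 \<odot> h 1 = idm C (X 0)"
    using eq[rule_format, of 0] plus_zero[OF comp_closed[OF d h1]] by simp
  then show ?thesis
    using h1 HomD[OF d] unfolding split_mono_def by auto
qed

text \<open>Composing a morphism \<open>g\<close> killed by the differential with \<open>d h + h d = 1\<close> leaves \<open>g = (g h) d\<close>.\<close>

lemma contractible_n_kernel:
  assumes "contractible C (n + 1) X d"
  shows "n_kernel C n X d"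
proof -
  have cs: "complex_sequence C (n + 1) X d"
    using assms by (simp add: contractible_def)
  have X: "X i \<in> Ob C" if "i \<le> n + 1" for i
    using cs that by (simp add: complex_sequence_def hom_sequence_def)
  have d: "d i \<in> Hom C (X i) (X (i + 1))" if "i \<le> n" for i
    using cs that by (simp add: complex_sequence_def hom_sequence_def)
  obtain h where h: "\<forall>i. 1 \<le> i \<and> i \<le> n + 1 \<longrightarrow> h i \<in> Hom C (X i) (X (i - 1))"
    and eq: "\<forall>i\<le>n + 1. idm C (X i) =
             (if i < n + 1 then d i \<odot> h (i + 1) else zerom C (X i) (X i)) \<boxplus>
             (if 0 < i then h i \<odot> d (i - 1) else zerom C (X i) (X i))"
    using assms unfolding contractible_def null_homotopic_def by blast
  have hH: "h (i + 1) \<in> Hom C (X (i + 1)) (X i)" if "i \<le> n" for i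
    using h[rule_format, of "i + 1"] that by simp
  show ?thesis
    unfolding n_kernel_iff
  proof (intro conjI allI impI ballI cs)
    fix Y g assume g: "g \<in> Hom C Y (X 0)" and 0: "g \<odot> d 0 = zerom C Y (X 1)"
    have d0: "d 0 \<in> Hom C (X 0) (X 1)" and h1: "h 1 \<in> Hom C (X 1) (X 0)"
      using d[of 0] hH[of 0] by simp_all
    have "d 0 \<odot> h 1 = idm C (X 0)"
      using eq[rule_format, of 0] plus_zero[OF comp_closed[OF d0 h1]] by simp
    then show "g = zerom C Y (X 0)"
      using comp_assoc[OF g d0 h1] 0 id_right[OF g] zero_comp[OF h1 Hom_Ob(1)[OF g]] by simp
  next
    fix i Y g assume i: "i < n" and g: "g \<in> Hom C Y (X (i + 1))"
      and 0: "g \<odot> d (i + 1) = zerom C Y (X (i + 2))"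
    have di: "d i \<in> Hom C (X i) (X (i + 1))" "d (i + 1) \<in> Hom C (X (i + 1)) (X (i + 2))"
      and hi: "h (i + 1) \<in> Hom C (X (i + 1)) (X i)" "h (i + 2) \<in> Hom C (X (i + 2)) (X (i + 1))"
      using d[of i] hH[of i] d[of "i + 1"] hH[of "i + 1"] i by simp_all
    have "idm C (X (i + 1)) = (d (i + 1) \<odot> h (i + 2)) \<boxplus> (h (i + 1) \<odot> d i)"
      using eq[rule_format, of "i + 1"] i by simp
    then have "g = (g \<odot> (d (i + 1) \<odot> h (i + 2))) \<boxplus> (g \<odot> (h (i + 1) \<odot> d i))"
      using comp_plus[OF g comp_closed[OF di(2) hi(2)] comp_closed[OF hi(1) di(1)]] id_right[OF g]
      by simp
    also have "g \<odot> (d (i + 1) \<odot> h (i + 2)) = zerom C Y (X (i + 1))"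
      using comp_assoc[OF g di(2) hi(2)] 0 zero_comp[OF hi(2) Hom_Ob(1)[OF g]] by simp
    finally have "g = g \<odot> (h (i + 1) \<odot> d i)"
      using zero_plus[OF comp_closed[OF g comp_closed[OF hi(1) di(1)]]] by simp
    then have "g = g \<odot> h (i + 1) \<odot> d i"
      using comp_assoc[OF g hi(1) di(1)] by simp
    then show "\<exists>k\<in>Hom C Y (X i). g = k \<odot> d i"
      using comp_closed[OF g hi(1)] by blast
  qed
qed

lemma n_cokernel_split_mono_n_exact:
  assumes "n_cokernel C n X d" "split_mono C (d 0)"
  shows "n_exact C n X d"
  using assms n_cokernel_contractible[OF assms] contractible_n_kernel
  by (simp add: n_exact_def contractible_def)

lemma n_kernel_mono:
  assumes "n_kernel C n X d"
  shows "monomorphism C (d 0)"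
proof (rule monomorphismI)
  show "d 0 \<in> Hom C (X 0) (X 1)"
    using assms by (simp add: n_kernel_def hom_sequence_def)
qed (use assms in \<open>auto simp: n_kernel_iff\<close>)

text \<open>The index \<open>i = n\<close> is the case of interest: there \<open>d i\<close> is the morphism whose n-kernel is taken.\<close>

lemma n_kernel_regular:
  assumes ic: "idempotent_complete C"
    and split_monos: "\<And>f. monomorphism C f \<Longrightarrow> split_mono C f"
    and nk: "n_kernel C n X d" and "i \<le> n"
  shows "regular_morphism C (d i)"
  using \<open>i \<le> n\<close>
proof (induction i)
  case 0
  then show ?case using n_kernel_mono[OF nk] split_monos split_mono_regular by blast
next
  case (Suc i)
  then have i: "i < n" by simp
  show ?case
  proof (rule regular_propagates[OF ic split_monos])
    show "d i \<in> Hom C (X i) (X (i + 1))" "d (Suc i) \<in> Hom C (X (i + 1)) (X (i + 2))"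
      "d i \<odot> d (Suc i) = zerom C (X i) (X (i + 2))"
      using nk i by (auto simp: n_kernel_iff complex_sequence_def hom_sequence_def)
    show "regular_morphism C (d i)" using Suc by simp
    show "\<exists>k\<in>Hom C W (X i). g = k \<odot> d i"
      if "g \<in> Hom C W (X (i + 1))" "g \<odot> d (Suc i) = zerom C W (X (i + 2))" for W g
      using nk i that by (simp add: n_kernel_iff)
  qed
qed

text \<open>If \<open>f h f = f\<close>, then \<open>f\<close> and the idempotent \<open>h f\<close> have the same cokernel, namely the
  projection to the complementary summand.\<close>

lemma regular_ex_cokernel:
  assumes ic: "idempotent_complete C" and f: "f \<in> Hom C A B" and reg: "regular_morphism C f"
  obtains K q where "q \<in> Hom C B K" "epimorphism C q" "f \<odot> q = zerom C A K"
    "\<And>Y g. g \<in> Hom C B Y \<Longrightarrow> f \<odot> g = zerom C A Y \<Longrightarrow> \<exists>k \<in> Hom C K Y. g = q \<odot> k"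
proof -
  obtain h where h: "h \<in> Hom C B A" "f \<odot> h \<odot> f = f"
    using regular_morphismE reg f by blast
  note hf = comp_closed[OF h(1) f]
  have f_hf: "f \<odot> (h \<odot> f) = f" using comp_assoc[OF f h(1) f] h(2) by simp
  have "h \<odot> f \<odot> (h \<odot> f) = h \<odot> f" using comp_assoc[OF h(1) f hf] f_hf by simp
  then obtain K q j where q: "q \<in> Hom C B K" and j: "j \<in> Hom C K B" and jq: "j \<odot> q = idm C K"
    and sum: "(q \<odot> j) \<boxplus> (h \<odot> f) = idm C B" and hfq: "h \<odot> f \<odot> q = zerom C B K"
    using split_complement[OF ic hf] by metis
  have "epimorphism C q"
    unfolding epimorphism_def
  proof (intro conjI ballI impI)
    fix Y g g' assume "g \<in> Hom C (tgt C q) Y" "g' \<in> Hom C (tgt C q) Y" and eq: "q \<odot> g = q \<odot> g'"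
    then have g: "g \<in> Hom C K Y" and g': "g' \<in> Hom C K Y" using HomD[OF q] by auto
    have "g = j \<odot> (q \<odot> g)" using comp_assoc[OF j q g] jq id_left[OF g] by simp
    also have "\<dots> = g'" using comp_assoc[OF j q g'] jq id_left[OF g'] eq by simp
    finally show "g = g'" .
  qed (use HomD[OF q] in simp)
  moreover have "f \<odot> q = zerom C A K"
    using comp_assoc[OF f hf q] f_hf hfq comp_zero[OF f Hom_Ob(2)[OF q]] by simp
  moreover have "\<exists>k \<in> Hom C K Y. g = q \<odot> k"
    if g: "g \<in> Hom C B Y" and 0: "f \<odot> g = zerom C A Y" for Y g
  proof -
    have "h \<odot> f \<odot> g = zerom C B Y"
      using comp_assoc[OF h(1) f g] 0 comp_zero[OF h(1) Hom_Ob(2)[OF g]] by simp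
    then have "g = q \<odot> j \<odot> g"
      using plus_comp[OF comp_closed[OF q j] hf g] sum id_left[OF g]
        plus_zero[OF comp_closed[OF comp_closed[OF q j] g]] by simp
    then show ?thesis using comp_assoc[OF q j g] comp_closed[OF j g] by auto
  qed
  ultimately show thesis using that q by blast
qed

end

context additive_category
begin

text \<open>The condition \<open>n \<ge> 1\<close> provides the position \<open>2\<close> for the cokernel object; all later objects
  can be zero because the cokernel is an epimorphism.\<close>

lemma regular_ex_n_cokernel:
  assumes ic: "idempotent_complete C" and reg: "regular_morphism C f" and n: "n \<ge> 1"
  shows "\<exists>X d. d 0 = f \<and> n_cokernel C n X d"
proof -
  have f: "f \<in> Hom C (src C f) (tgt C f)" (is "_ \<in> Hom C ?A ?B")
    using reg by (simp add: regular_morphism_def Hom_def)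
  obtain K q where q: "q \<in> Hom C ?B K" and epi: "epimorphism C q" and fq: "f \<odot> q = zerom C ?A K"
    and coker: "\<And>Y g. g \<in> Hom C ?B Y \<Longrightarrow> f \<odot> g = zerom C ?A Y \<Longrightarrow> \<exists>k \<in> Hom C K Y. g = q \<odot> k"
    using regular_ex_cokernel[OF ic f reg] by metis
  obtain Z where Z: "zero_object C Z" using ex_zero_object by blast
  have ZOb: "Z \<in> Ob C" using Z by (simp add: zero_object_def)
  have from_Z: "g = zerom C Z Y" if "g \<in> Hom C Z Y" for g Y
    using Z Hom_Ob(2)[OF that] that zero_closed[OF ZOb] unfolding zero_object_def by blast
  have q_cancel: "g = zerom C K Y" if g: "g \<in> Hom C K Y" and 0: "q \<odot> g = zerom C ?B Y" for g Y
  proof -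
    have Y: "Y \<in> Ob C" "K \<in> Ob C" using Hom_Ob[OF g] by auto
    have "q \<odot> g = q \<odot> zerom C K Y" using 0 comp_zero[OF q Y(1)] by simp
    then show ?thesis
      using epi g zero_closed[OF Y(2,1)] Y HomD[OF q] unfolding epimorphism_def by blast
  qed
  define X where "X = (\<lambda>i::nat. if i = 0 then ?A else if i = 1 then ?B else if i = 2 then K else Z)"
  define d where "d = (\<lambda>i. if i = 0 then f else if i = 1 then q else zerom C (X i) Z)"
  have Xs: "X 0 = ?A" "X (Suc 0) = ?B" "X 2 = K" "X (Suc (Suc 0)) = K" by (simp_all add: X_def numeral_2_eq_2)
  have XOb: "X i \<in> Ob C" for i
    using Hom_Ob[OF f] Hom_Ob[OF q] ZOb by (simp add: X_def)
  have XZ: "X i = Z" if "i \<ge> 3" for i using that by (simp add: X_def)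
  have ds: "d 0 = f" "d (Suc 0) = q" by (simp_all add: d_def)
  have dZ: "d i = zerom C (X i) (X (Suc i))" if "i \<ge> 2" for i
    using that XZ[of "Suc i"] by (simp add: d_def)
  have dH: "d i \<in> Hom C (X i) (X (Suc i))" for i
  proof -
    consider "i = 0" | "i = 1" | "i \<ge> 2" by linarith
    then show ?thesis
      by cases (use f q dZ zero_closed[OF XOb XOb] in \<open>auto simp: Xs ds\<close>)
  qed
  have "n_cokernel C n X d"
    unfolding n_cokernel_iff complex_sequence_def hom_sequence_def
  proof (intro conjI allI impI ballI)
    show "X i \<in> Ob C" for i by (rule XOb)
    show "d i \<in> Hom C (X i) (X (i + 1))" for i using dH[of i] by simp
  next
    fix i
    show "d i \<odot> d (i + 1) = zerom C (X i) (X (i + 2))"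
    proof (cases "i = 0")
      case True
      then show ?thesis using fq by (simp add: Xs ds)
    next
      case False
      then show ?thesis using dZ[of "Suc i"] comp_zero[OF dH XOb, of i "i + 2"] by simp
    qed
  next
    fix Y g assume g: "g \<in> Hom C (X (n + 1)) Y" and 0: "d n \<odot> g = zerom C (X n) Y"
    show "g = zerom C (X (n + 1)) Y"
    proof (cases "n = 1")
      case True
      then show ?thesis using q_cancel[of g Y] g 0 by (simp add: Xs ds)
    next
      case False
      then show ?thesis using from_Z[of g Y] g XZ[of "n + 1"] n by simp
    qed
  next
    fix i Y g assume g: "g \<in> Hom C (X (i + 1)) Y" and 0: "d i \<odot> g = zerom C (X i) Y"
    show "\<exists>k\<in>Hom C (X (i + 2)) Y. g = d (i + 1) \<odot> k"
    proof (cases "i = 0")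
      case True
      then show ?thesis using coker[of g Y] g 0 by (simp add: Xs ds)
    next
      case False
      have Y: "Y \<in> Ob C" using Hom_Ob[OF g] by simp
      have "g = zerom C (X (i + 1)) Y"
      proof (cases "i = 1")
        case True
        then show ?thesis using q_cancel[of g Y] g 0 by (simp add: Xs ds)
      next
        case False
        then show ?thesis using from_Z[of g Y] g XZ[of "i + 1"] \<open>i \<noteq> 0\<close> by simp
      qed
      then show ?thesis
        using comp_zero[OF dH[of "i + 1"] Y] zero_closed[OF XOb[of "i + 2"] Y]
        by (intro bexI[of _ "zerom C (X (i + 2)) Y"]) simp_all
    qed
  qed
  then show ?thesis using ds by blast
qed

end

section \<open>Semisimplicity and n-abelian categories\<close>

lemma semisimple_n_abelian:
  assumes "additive_category C" and ss: "semisimple C" and n: "n \<ge> 1"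
  shows "n_abelian_category C n"
proof -
  interpret additive_category C by fact
  interpret opp: additive_category "opposite C"
    by (rule additive_category_opposite) fact
  note pre = preadditive_category_axioms and pre' = opp.preadditive_category_axioms
  have ss': "semisimple (opposite C)"
    using semisimple_opposite[OF pre ss] .
  note reg = ss[unfolded semisimple_iff_regular] and reg' = ss'[unfolded opp.semisimple_iff_regular]
  show ?thesis
  proof
    show "idempotent_complete C" using reg by blast
  next
    fix f assume "f \<in> Mor C"
    then show "\<exists>X d. d 0 = f \<and> n_cokernel C n X d"
      using regular_ex_n_cokernel reg n by blast
  next
    fix f assume "f \<in> Mor C"
    then obtain X d where d: "d 0 = f" and nc: "n_cokernel (opposite C) n X d"
      using opp.regular_ex_n_cokernel[of f n] reg' n by auto
    obtain X' d' where rev: "reversed n X d X' d'" using ex_reversed by blast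
    have "n_kernel C n X' d'"
      using n_cokernel_reversed[OF pre' rev nc] by simp
    moreover have "d' n = f" using rev d by (simp add: reversed_def)
    ultimately show "\<exists>X d. d n = f \<and> n_kernel C n X d" by blast
  next
    fix X d assume "monomorphism C (d 0)" "n_cokernel C n X d"
    moreover from this have "regular_morphism C (d 0)"
      using reg unfolding monomorphism_def by blast
    ultimately show "n_exact C n X d"
      using n_cokernel_split_mono_n_exact regular_mono_split by blast
  next
    fix X d assume epi: "epimorphism C (d n)" and nk: "n_kernel C n X d"
    obtain X' d' where rev: "reversed n X d X' d'" using ex_reversed by blast
    have "d' 0 = d n" using rev by (simp add: reversed_def)
    then have mono: "monomorphism (opposite C) (d' 0)" using epi by simp
    then have "regular_morphism (opposite C) (d' 0)"
      using reg' unfolding monomorphism_def by blast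
    then have "split_mono (opposite C) (d' 0)"
      using opp.regular_mono_split mono by blast
    then have "n_exact (opposite C) n X' d'"
      using opp.n_cokernel_split_mono_n_exact n_kernel_reversed[OF pre rev nk] by blast
    then show "n_exact C n X d"
      using n_exact_reversed[OF pre' reversed_sym[OF rev]] by simp
  qed
qed

theorem theorem3p9:
  fixes C :: "('o, 'm, 'e) precat_scheme" and n :: nat
  assumes "additive_category C" and "n \<ge> 1"
  shows "(n_abelian_category C n \<and> (\<forall>X d. n_exact C n X d \<longrightarrow> contractible C (n + 1) X d))
    \<longleftrightarrow> semisimple C"
proof
  assume L: "n_abelian_category C n \<and> (\<forall>X d. n_exact C n X d \<longrightarrow> contractible C (n + 1) X d)"
  then interpret n_abelian_category C n by blast
  have split_monos: "split_mono C f" if mono: "monomorphism C f" for f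
  proof -
    obtain X d where "d 0 = f" "n_cokernel C n X d"
      using A1_cokernel mono unfolding monomorphism_def by blast
    then show ?thesis
      using A2 mono L contractible_split_mono by blast
  qed
  have "regular_morphism C f" if "f \<in> Mor C" for f
    using A1_kernel[OF that] n_kernel_regular[OF A0 split_monos] by blast
  then show "semisimple C"
    using A0 semisimple_iff_regular by blast
next
  assume ss: "semisimple C"
  interpret additive_category C by fact
  have "contractible C (n + 1) X d" if ex: "n_exact C n X d" for X d
  proof -
    have mono: "monomorphism C (d 0)"
      using ex n_kernel_mono by (auto simp: n_exact_def)
    then have "split_mono C (d 0)"
      using ss regular_mono_split unfolding semisimple_iff_regular monomorphism_def by blast
    then show ?thesis
      using ex n_cokernel_contractible by (simp add: n_exact_def)
  qed
  then show "n_abelian_category C n \<and> (\<forall>X d. n_exact C n X d \<longrightarrow> contractible C (n + 1) X d)"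
    using semisimple_n_abelian[OF assms(1) ss assms(2)] by blast
qed

end
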